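(* Let $\alpha_0,\dots,\alpha_6$ be complex parameters with $\alpha_0+\alpha_1+2\alpha_2+2\alpha_3+2\alpha_4+\alpha_5+\alpha_6=1$, and consider the Hamiltonian system $$\frac{dx}{dt}=\frac{\partial H}{\partial y},\ \frac{dy}{dt}=-\frac{\partial H}{\partial x},\ \frac{dz}{dt}=\frac{\partial H}{\partial w},\ \frac{dw}{dt}=-\frac{\partial H}{\partial z},\ \frac{dq}{dt}=\frac{\partial H}{\partial p},\ \frac{dp}{dt}=-\frac{\partial H}{\partial q}$$ with $$\begin{aligned} tH={}&x^2(y-1)y+x\{(\alpha_0+\alpha_1)y-\alpha_1\}+ty+z^2(w-1)w+z\{(\alpha_0+\alpha_1+2\alpha_2+2\alpha_3)w-\alpha_3\}+tw\\&+q^2(p-t)p+q\{(\alpha_5+\alpha_6-1)p-t\alpha_5\}+p+2yz(zw+\alpha_3)-2(y+w)p.\end{aligned}$$ For $\varepsilon\neq0$ make the change of parameters and variables $$\alpha_0=\frac1\varepsilon+2A_0,\ \alpha_1=-\frac1\varepsilon,\ \alpha_2=A_1,\ \alpha_3=A_2,\ \alpha_4=A_3,\ \alpha_5=A_4,\ \alpha_6=A_5,$$ $$t=\varepsilon T,\ x=\varepsilon X,\ y=\frac{Y}{\varepsilon},\ z=\varepsilon Z,\ w=\frac{W}{\varepsilon},\ q=\frac{Q}{\varepsilon},\ p=\varepsilon P$$ from $\alpha_0,\dots,\alpha_6,t,x,y,z,w,q,p$ to $A_0,\dots,A_5,T,X,Y,Z,W,Q,P$. Then the system can also be written in the new variables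 $X,Y,Z,W,Q,P$ (with independent variable $T$) and parameters $A_0,\dots,A_5$ as a Hamiltonian system, and this new system tends, as $\varepsilon\to0$, to the Hamiltonian system (in the canonical pairs $(X,Y),(Z,W),(Q,P)$ and independent variable $T$) with Hamiltonian $$\begin{aligned}\frac1T\Big[&X^2Y^2+2A_0XY+X+TY+Z^2W^2+2(A_0+A_1+A_2)ZW+TW\\&+Q^2P^2-TQ^2P+(A_4+A_5-1)QP-A_4TQ+2YZ(ZW+A_2)-2(Y+W)P\Big],\end{aligned}$$ where $2A_0+2A_1+2A_2+2A_3+A_4+A_5=1$.
   Context: A Hamiltonian system with Hamiltonian $K$ in canonical pairs $(X,Y),(Z,W),(Q,P)$ and time $T$ means $\frac{dX}{dT}=\frac{\partial K}{\partial Y},\ \frac{dY}{dT}=-\frac{\partial K}{\partial X}$, and similarly for $(Z,W)$ and $(Q,P)$. "Tends to" means that the right-hand sides of the differential equations converge as $\varepsilon\to0$ with $X,Y,Z,W,Q,P,T,A_i$ fixed. *)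

theory Defs
  imports "HOL-Analysis.Analysis"
begin

text \<open>Points of phase space, in the order (X, Y, Z, W, Q, P) with canonical pairs
  (X, Y), (Z, W), (Q, P).  A time-dependent Hamiltonian takes the time first.\<close>

type_synonym phase = "complex \<times> complex \<times> complex \<times> complex \<times> complex \<times> complex"

type_synonym hamiltonian = "complex \<Rightarrow> phase \<Rightarrow> complex"

text \<open>Complex differentiability in each phase variable separately; by Hartogs' theorem this is
  the same as being holomorphic on the whole of phase space.  It guarantees that the values
  of \<^const>\<open>deriv\<close> below are genuine partial derivatives.\<close>

definition separately_holomorphic :: "(phase \<Rightarrow> complex) \<Rightarrow> bool" where
  "separately_holomorphic f \<longleftrightarrow> (\<forall>X Y Z W Q P.
     (\<lambda>s. f (s, Y, Z, W, Q, P)) field_differentiable at X \<and>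
     (\<lambda>s. f (X, s, Z, W, Q, P)) field_differentiable at Y \<and>
     (\<lambda>s. f (X, Y, s, W, Q, P)) field_differentiable at Z \<and>
     (\<lambda>s. f (X, Y, Z, s, Q, P)) field_differentiable at W \<and>
     (\<lambda>s. f (X, Y, Z, W, s, P)) field_differentiable at Q \<and>
     (\<lambda>s. f (X, Y, Z, W, Q, s)) field_differentiable at P)"

text \<open>The right-hand sides of the Hamiltonian system, listed as
  (dX/dT, dY/dT, dZ/dT, dW/dT, dQ/dT, dP/dT).\<close>

fun hamiltonian_rhs :: "hamiltonian \<Rightarrow> complex \<Rightarrow> phase \<Rightarrow> phase" where
  "hamiltonian_rhs K T (X, Y, Z, W, Q, P) =
     (  deriv (\<lambda>s. K T (X, s, Z, W, Q, P)) Y,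
      - deriv (\<lambda>s. K T (s, Y, Z, W, Q, P)) X,
        deriv (\<lambda>s. K T (X, Y, Z, s, Q, P)) W,
      - deriv (\<lambda>s. K T (X, Y, s, W, Q, P)) Z,
        deriv (\<lambda>s. K T (X, Y, Z, W, Q, s)) P,
      - deriv (\<lambda>s. K T (X, Y, Z, W, s, P)) Q)"

definition solves_hamiltonian_system ::
  "hamiltonian \<Rightarrow> complex set \<Rightarrow> (complex \<Rightarrow> complex) \<Rightarrow> (complex \<Rightarrow> complex) \<Rightarrow>
   (complex \<Rightarrow> complex) \<Rightarrow> (complex \<Rightarrow> complex) \<Rightarrow> (complex \<Rightarrow> complex) \<Rightarrow>
   (complex \<Rightarrow> complex) \<Rightarrow> bool" where
  "solves_hamiltonian_system K D X Y Z W Q P \<longleftrightarrow> (\<forall>T\<in>D.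
     case hamiltonian_rhs K T (X T, Y T, Z T, W T, Q T, P T) of
       (dX, dY, dZ, dW, dQ, dP) \<Rightarrow>
         (X has_field_derivative dX) (at T) \<and> (Y has_field_derivative dY) (at T) \<and>
         (Z has_field_derivative dZ) (at T) \<and> (W has_field_derivative dW) (at T) \<and>
         (Q has_field_derivative dQ) (at T) \<and> (P has_field_derivative dP) (at T))"

text \<open>Parameters are indexed by natural numbers; only \<open>\<alpha> 0, \<dots>, \<alpha> 6\<close> and
  \<open>A 0, \<dots>, A 5\<close> are ever used.\<close>

definition alpha_normalized :: "(nat \<Rightarrow> complex) \<Rightarrow> bool" where
  "alpha_normalized \<alpha> \<longleftrightarrow>
     \<alpha> 0 + \<alpha> 1 + 2 * \<alpha> 2 + 2 * \<alpha> 3 + 2 * \<alpha> 4 + \<alpha> 5 + \<alpha> 6 = 1"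

definition A_normalized :: "(nat \<Rightarrow> complex) \<Rightarrow> bool" where
  "A_normalized A \<longleftrightarrow>
     2 * A 0 + 2 * A 1 + 2 * A 2 + 2 * A 3 + A 4 + A 5 = 1"

fun H :: "(nat \<Rightarrow> complex) \<Rightarrow> hamiltonian" where
  "H \<alpha> t (x, y, z, w, q, p) =
     (x^2 * (y - 1) * y + x * ((\<alpha> 0 + \<alpha> 1) * y - \<alpha> 1) + t * y
      + z^2 * (w - 1) * w + z * ((\<alpha> 0 + \<alpha> 1 + 2 * \<alpha> 2 + 2 * \<alpha> 3) * w - \<alpha> 3) + t * w
      + q^2 * (p - t) * p + q * ((\<alpha> 5 + \<alpha> 6 - 1) * p - t * \<alpha> 5) + p
      + 2 * y * z * (z * w + \<alpha> 3) - 2 * (y + w) * p) / t"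

fun H_lim :: "(nat \<Rightarrow> complex) \<Rightarrow> hamiltonian" where
  "H_lim A T (X, Y, Z, W, Q, P) =
     1 / T *
     (X^2 * Y^2 + 2 * A 0 * X * Y + X + T * Y
      + Z^2 * W^2 + 2 * (A 0 + A 1 + A 2) * Z * W + T * W
      + Q^2 * P^2 - T * Q^2 * P + (A 4 + A 5 - 1) * Q * P - A 4 * T * Q
      + 2 * Y * Z * (Z * W + A 2) - 2 * (Y + W) * P)"

definition parameter_change :: "complex \<Rightarrow> (nat \<Rightarrow> complex) \<Rightarrow> (nat \<Rightarrow> complex) \<Rightarrow> bool" where
  "parameter_change \<epsilon> \<alpha> A \<longleftrightarrow>
     \<alpha> 0 = 1 / \<epsilon> + 2 * A 0 \<and> \<alpha> 1 = - 1 / \<epsilon> \<and> \<alpha> 2 = A 1 \<and> \<alpha> 3 = A 2 \<and>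
     \<alpha> 4 = A 3 \<and> \<alpha> 5 = A 4 \<and> \<alpha> 6 = A 5"

text \<open>The lower-case curves are functions of the old time \<open>t = \<epsilon> * T\<close>, the upper-case curves
  are functions of the new time \<open>T\<close>, which ranges over \<open>D\<close>.\<close>

definition variable_change ::
  "complex \<Rightarrow> complex set \<Rightarrow>
   (complex \<Rightarrow> complex) \<Rightarrow> (complex \<Rightarrow> complex) \<Rightarrow> (complex \<Rightarrow> complex) \<Rightarrow>
   (complex \<Rightarrow> complex) \<Rightarrow> (complex \<Rightarrow> complex) \<Rightarrow> (complex \<Rightarrow> complex) \<Rightarrow>
   (complex \<Rightarrow> complex) \<Rightarrow> (complex \<Rightarrow> complex) \<Rightarrow> (complex \<Rightarrow> complex) \<Rightarrow>
   (complex \<Rightarrow> complex) \<Rightarrow> (complex \<Rightarrow> complex) \<Rightarrow> (complex \<Rightarrow> complex) \<Rightarrow> bool" where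
  "variable_change \<epsilon> D x y z w q p X Y Z W Q P \<longleftrightarrow> (\<forall>T\<in>D.
     x (\<epsilon> * T) = \<epsilon> * X T \<and> y (\<epsilon> * T) = Y T / \<epsilon> \<and>
     z (\<epsilon> * T) = \<epsilon> * Z T \<and> w (\<epsilon> * T) = W T / \<epsilon> \<and>
     q (\<epsilon> * T) = Q T / \<epsilon> \<and> p (\<epsilon> * T) = \<epsilon> * P T)"

text \<open>The system with Hamiltonian \<open>H \<alpha>\<close>, rewritten in the new variables, is the Hamiltonian
  system with Hamiltonian \<open>K\<close>: over every open set of nonzero times, curves that correspond
  under the change of variables solve the one system iff they solve the other.\<close>

definition rewrites_as_hamiltonian_system ::
  "complex \<Rightarrow> (nat \<Rightarrow> complex) \<Rightarrow> hamiltonian \<Rightarrow> bool" where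
  "rewrites_as_hamiltonian_system \<epsilon> \<alpha> K \<longleftrightarrow>
     (\<forall>T. T \<noteq> 0 \<longrightarrow> separately_holomorphic (K T)) \<and>
     (\<forall>D x y z w q p X Y Z W Q P.
        open D \<and> 0 \<notin> D \<and> variable_change \<epsilon> D x y z w q p X Y Z W Q P \<longrightarrow>
        (solves_hamiltonian_system (H \<alpha>) ((\<lambda>T. \<epsilon> * T) ` D) x y z w q p \<longleftrightarrow>
         solves_hamiltonian_system K D X Y Z W Q P))"

end

theory Submission
  imports Defs
begin

text \<open>The substitution is a constant scaling that is symplectic: in each canonical pair one
  variable is multiplied by \<open>\<epsilon>\<close> and its partner is divided by \<open>\<epsilon>\<close>.  Such a map carries Hamiltonian
  systems to Hamiltonian systems without changing the Hamiltonian, and the change of time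
  \<open>t = \<epsilon> * T\<close> multiplies the Hamiltonian by \<open>\<epsilon>\<close>.  Hence the new Hamiltonian is
  \<open>\<epsilon> * H \<alpha> (\<epsilon> * T)\<close> evaluated at the rescaled point; this is the content of
  \<open>solves_hamiltonian_system_rescale\<close> and holds for any holomorphic Hamiltonian.

  For the particular \<open>H\<close>, all negative powers of \<open>\<epsilon>\<close> cancel: \<open>\<alpha> 0\<close> and \<open>\<alpha> 1\<close> occur only through
  the sum \<open>\<alpha> 0 + \<alpha> 1 = 2 * A 0\<close>, apart from the term \<open>- x * \<alpha> 1\<close>, which becomes exactly \<open>X\<close>.
  What remains is affine in \<open>\<epsilon>\<close>, namely \<open>H_lim A + \<epsilon> * R\<close> with \<open>R\<close> independent of \<open>\<epsilon>\<close>
  (\<open>H_eps_eq_rescaled_H\<close>).  Since the right-hand sides of a Hamiltonian system are linear in the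
  Hamiltonian, they converge to those of \<open>H_lim A\<close>
  (\<open>tendsto_hamiltonian_rhs_affine\<close>).\<close>

fun rescale :: "complex \<Rightarrow> phase \<Rightarrow> phase" where
  "rescale \<epsilon> (X, Y, Z, W, Q, P) = (\<epsilon> * X, Y / \<epsilon>, \<epsilon> * Z, W / \<epsilon>, Q / \<epsilon>, \<epsilon> * P)"

text \<open>This is the chain rule for the substitution; the outer factor \<open>a\<close> is the one by which the
  change of time multiplies the Hamiltonian.\<close>

lemma deriv_scaled:
  fixes f :: "complex \<Rightarrow> complex"
  assumes "f field_differentiable at (c * u)"
  shows "deriv (\<lambda>s. a * f (c * s)) u = a * c * deriv f (c * u)"
proof (rule DERIV_imp_deriv)
  have "(f has_field_derivative deriv f (c * u)) (at (c * u))"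
    using assms by (simp add: DERIV_deriv_iff_field_differentiable)
  then have "((\<lambda>s. f (c * s)) has_field_derivative deriv f (c * u) * c) (at u)"
    by (rule DERIV_chain2) (auto intro!: derivative_eq_intros)
  then show "((\<lambda>s. a * f (c * s)) has_field_derivative a * c * deriv f (c * u)) (at u)"
    by (auto intro!: derivative_eq_intros)
qed

lemma deriv_affine_perturbation:
  fixes f g :: "complex \<Rightarrow> complex"
  assumes "f field_differentiable at u" "g field_differentiable at u"
  shows "deriv (\<lambda>s. f s + c * g s) u = deriv f u + c * deriv g u"
  using DERIV_add[OF _ DERIV_cmult, of f "deriv f u" u UNIV g "deriv g u" c] assms
  by (intro DERIV_imp_deriv) (simp add: DERIV_deriv_iff_field_differentiable)

text \<open>The change of time multiplies every rate of change by \<open>\<epsilon>\<close>, and the scaling of a variable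
  divides its rate by the scaling factor: the net factor is \<open>1\<close> for the variables multiplied
  by \<open>\<epsilon>\<close> and \<open>\<epsilon>\<^sup>2\<close> for those divided by it.  The Hamiltonian form reproduces these
  factors because the partial derivative is taken in the conjugate variable.\<close>

lemma hamiltonian_rhs_rescale:
  assumes "\<epsilon> \<noteq> 0" and "separately_holomorphic (G (\<epsilon> * T))"
    and "hamiltonian_rhs G (\<epsilon> * T) (rescale \<epsilon> (X, Y, Z, W, Q, P)) = (dx, dy, dz, dw, dq, dp)"
  shows "hamiltonian_rhs (\<lambda>T s. \<epsilon> * G (\<epsilon> * T) (rescale \<epsilon> s)) T (X, Y, Z, W, Q, P) =
    (dx, \<epsilon>\<^sup>2 * dy, dz, \<epsilon>\<^sup>2 * dw, \<epsilon>\<^sup>2 * dq, dp)"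
proof -
  note hol = assms(2)[unfolded separately_holomorphic_def, rule_format]
  note diffs = hol[THEN conjunct1]
    hol[THEN conjunct2, THEN conjunct1]
    hol[THEN conjunct2, THEN conjunct2, THEN conjunct1]
    hol[THEN conjunct2, THEN conjunct2, THEN conjunct2, THEN conjunct1]
    hol[THEN conjunct2, THEN conjunct2, THEN conjunct2, THEN conjunct2, THEN conjunct1]
    hol[THEN conjunct2, THEN conjunct2, THEN conjunct2, THEN conjunct2, THEN conjunct2]
  have mult: "deriv (\<lambda>s. \<epsilon> * f (\<epsilon> * s)) u = \<epsilon>\<^sup>2 * deriv f (\<epsilon> * u)"
    if "\<And>v. f field_differentiable at v" for f u
    using deriv_scaled[OF that, of \<epsilon> \<epsilon> u] by (simp add: power2_eq_square)
  have div: "deriv (\<lambda>s. \<epsilon> * f (s / \<epsilon>)) u = deriv f (u / \<epsilon>)"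
    if "\<And>v. f field_differentiable at v" for f u
    using deriv_scaled[OF that, of \<epsilon> "1 / \<epsilon>" u] assms(1) by simp
  note partials = mult[OF diffs(1)] div[OF diffs(2)] mult[OF diffs(3)] div[OF diffs(4)]
    div[OF diffs(5)] mult[OF diffs(6)]
  show ?thesis
    using assms(3) by (auto simp: partials)
qed

text \<open>Both curves determine each other near the point in question, because \<open>D\<close> is open and
  \<open>\<epsilon>\<close> and \<open>c\<close> do not vanish.\<close>

lemma has_field_derivative_rescaled_curve_iff:
  fixes u U :: "complex \<Rightarrow> complex"
  assumes "open D" "T \<in> D" "\<epsilon> \<noteq> 0" "c \<noteq> 0"
    and curve: "\<And>T. T \<in> D \<Longrightarrow> u (\<epsilon> * T) = c * U T"
  shows "(u has_field_derivative d) (at (\<epsilon> * T)) \<longleftrightarrow>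
    (U has_field_derivative \<epsilon> * d / c) (at T)"
proof
  assume "(u has_field_derivative d) (at (\<epsilon> * T))"
  then have "((\<lambda>T. u (\<epsilon> * T)) has_field_derivative d * \<epsilon>) (at T)"
    by (rule DERIV_chain2) (auto intro!: derivative_eq_intros)
  then have "((\<lambda>T. u (\<epsilon> * T) / c) has_field_derivative \<epsilon> * d / c) (at T)"
    using \<open>c \<noteq> 0\<close> by (auto intro!: derivative_eq_intros)
  then show "(U has_field_derivative \<epsilon> * d / c) (at T)"
    by (rule has_field_derivative_transform_within_open[OF _ assms(1,2)])
       (use curve \<open>c \<noteq> 0\<close> in auto)
next
  assume "(U has_field_derivative \<epsilon> * d / c) (at T)"
  then have "(U has_field_derivative \<epsilon> * d / c) (at (\<epsilon> * T / \<epsilon>))"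
    using \<open>\<epsilon> \<noteq> 0\<close> by simp
  then have "((\<lambda>t. U (t / \<epsilon>)) has_field_derivative \<epsilon> * d / c * (1 / \<epsilon>)) (at (\<epsilon> * T))"
    by (rule DERIV_chain2) (use \<open>\<epsilon> \<noteq> 0\<close> in \<open>auto intro!: derivative_eq_intros\<close>)
  then have "((\<lambda>t. c * U (t / \<epsilon>)) has_field_derivative d) (at (\<epsilon> * T))"
    using \<open>\<epsilon> \<noteq> 0\<close> \<open>c \<noteq> 0\<close> by (auto intro!: derivative_eq_intros)
  moreover have "open ((\<lambda>T. \<epsilon> * T) ` D)"
  proof -
    have "(\<lambda>T. \<epsilon> * T) ` D = (\<lambda>t. t / \<epsilon>) -` D"
      using \<open>\<epsilon> \<noteq> 0\<close> by (auto intro!: image_eqI)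
    then show ?thesis
      using \<open>open D\<close> \<open>\<epsilon> \<noteq> 0\<close> by (auto intro!: open_vimage continuous_intros)
  qed
  ultimately show "(u has_field_derivative d) (at (\<epsilon> * T))"
    by (rule has_field_derivative_transform_within_open)
       (use assms curve in auto)
qed

text \<open>The factor \<open>\<epsilon>\<close> comes from the chain rule in time and the conjugate factors of \<open>rescale\<close>
  cancel within each canonical pair, so no Jacobian appears.\<close>

lemma solves_hamiltonian_system_rescale:
  assumes "\<epsilon> \<noteq> 0" "open D" and hol: "\<And>T. T \<in> D \<Longrightarrow> separately_holomorphic (G (\<epsilon> * T))"
    and change: "variable_change \<epsilon> D x y z w q p X Y Z W Q P"
  shows "solves_hamiltonian_system G ((\<lambda>T. \<epsilon> * T) ` D) x y z w q p \<longleftrightarrow>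
    solves_hamiltonian_system (\<lambda>T s. \<epsilon> * G (\<epsilon> * T) (rescale \<epsilon> s)) D X Y Z W Q P"
proof -
  have "(case hamiltonian_rhs G (\<epsilon> * T) (x (\<epsilon> * T), y (\<epsilon> * T), z (\<epsilon> * T), w (\<epsilon> * T),
           q (\<epsilon> * T), p (\<epsilon> * T)) of (dx, dy, dz, dw, dq, dp) \<Rightarrow>
       (x has_field_derivative dx) (at (\<epsilon> * T)) \<and> (y has_field_derivative dy) (at (\<epsilon> * T)) \<and>
       (z has_field_derivative dz) (at (\<epsilon> * T)) \<and> (w has_field_derivative dw) (at (\<epsilon> * T)) \<and>
       (q has_field_derivative dq) (at (\<epsilon> * T)) \<and> (p has_field_derivative dp) (at (\<epsilon> * T)))
    \<longleftrightarrow> (case hamiltonian_rhs (\<lambda>T s. \<epsilon> * G (\<epsilon> * T) (rescale \<epsilon> s)) T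
           (X T, Y T, Z T, W T, Q T, P T) of (dX, dY, dZ, dW, dQ, dP) \<Rightarrow>
       (X has_field_derivative dX) (at T) \<and> (Y has_field_derivative dY) (at T) \<and>
       (Z has_field_derivative dZ) (at T) \<and> (W has_field_derivative dW) (at T) \<and>
       (Q has_field_derivative dQ) (at T) \<and> (P has_field_derivative dP) (at T))"
    (is "?old \<longleftrightarrow> ?new") if "T \<in> D" for T
  proof -
    obtain dx dy dz dw dq dp where rhs:
      "hamiltonian_rhs G (\<epsilon> * T) (rescale \<epsilon> (X T, Y T, Z T, W T, Q T, P T))
        = (dx, dy, dz, dw, dq, dp)"
      by (metis prod.exhaust)
    have point: "(x (\<epsilon> * T), y (\<epsilon> * T), z (\<epsilon> * T), w (\<epsilon> * T), q (\<epsilon> * T), p (\<epsilon> * T)) =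
      rescale \<epsilon> (X T, Y T, Z T, W T, Q T, P T)"
      using change that by (simp add: variable_change_def)
    note iff = has_field_derivative_rescaled_curve_iff[OF assms(2) that assms(1)]
    have mult: "(u has_field_derivative d) (at (\<epsilon> * T)) \<longleftrightarrow> (U has_field_derivative d) (at T)"
      if "\<And>T. T \<in> D \<Longrightarrow> u (\<epsilon> * T) = \<epsilon> * U T" for u U d
      using iff[of \<epsilon> u U d] that assms(1) by simp
    have div: "(u has_field_derivative d) (at (\<epsilon> * T)) \<longleftrightarrow>
        (U has_field_derivative \<epsilon>\<^sup>2 * d) (at T)"
      if "\<And>T. T \<in> D \<Longrightarrow> u (\<epsilon> * T) = U T / \<epsilon>" for u U d
      using iff[of "1 / \<epsilon>" u U d] that assms(1) by (simp add: power2_eq_square mult_ac)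
    have "?old \<longleftrightarrow>
       (x has_field_derivative dx) (at (\<epsilon> * T)) \<and> (y has_field_derivative dy) (at (\<epsilon> * T)) \<and>
       (z has_field_derivative dz) (at (\<epsilon> * T)) \<and> (w has_field_derivative dw) (at (\<epsilon> * T)) \<and>
       (q has_field_derivative dq) (at (\<epsilon> * T)) \<and> (p has_field_derivative dp) (at (\<epsilon> * T))"
      unfolding point rhs by simp
    also have "\<dots> \<longleftrightarrow>
       (X has_field_derivative dx) (at T) \<and> (Y has_field_derivative \<epsilon>\<^sup>2 * dy) (at T) \<and>
       (Z has_field_derivative dz) (at T) \<and> (W has_field_derivative \<epsilon>\<^sup>2 * dw) (at T) \<and>
       (Q has_field_derivative \<epsilon>\<^sup>2 * dq) (at T) \<and> (P has_field_derivative dp) (at T)"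
      using change mult[of x X dx] div[of y Y dy] mult[of z Z dz] div[of w W dw]
        div[of q Q dq] mult[of p P dp]
      by (simp add: variable_change_def)
    also have "\<dots> \<longleftrightarrow> ?new"
      unfolding hamiltonian_rhs_rescale[OF assms(1) hol[OF that] rhs] by simp
    finally show ?thesis .
  qed
  then show ?thesis
    by (simp add: solves_hamiltonian_system_def)
qed

lemma tendsto_hamiltonian_rhs_affine:
  assumes "separately_holomorphic (F T)" "separately_holomorphic (R T)"
  shows "((\<lambda>\<epsilon>. hamiltonian_rhs (\<lambda>T s. F T s + \<epsilon> * R T s) T s) \<longlongrightarrow> hamiltonian_rhs F T s) (at 0)"
proof -
  obtain X Y Z W Q P where s: "s = (X, Y, Z, W, Q, P)"
    by (metis prod.exhaust)
  have lim: "((\<lambda>\<epsilon>. a + \<epsilon> * b) \<longlongrightarrow> a) (at 0)" for a b :: complex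
    by (auto intro!: tendsto_eq_intros)
  have lim_uminus: "((\<lambda>\<epsilon>. - (a + \<epsilon> * b)) \<longlongrightarrow> - a) (at 0)" for a b :: complex
    using lim by (rule tendsto_minus)
  show ?thesis
    using assms unfolding s separately_holomorphic_def
    by (simp add: deriv_affine_perturbation tendsto_Pair lim lim_uminus del: minus_add_distrib)
qed

text \<open>The part of the new Hamiltonian that is of first order in \<open>\<epsilon>\<close>: it collects the terms
  \<open>- x\<^sup>2 * y\<close>, \<open>- z\<^sup>2 * w\<close>, \<open>- z * \<alpha> 3\<close> and \<open>p\<close> of \<open>t * H\<close>, which have weight one under
  \<open>rescale\<close>.\<close>

fun H_correction :: "(nat \<Rightarrow> complex) \<Rightarrow> hamiltonian" where
  "H_correction A T (X, Y, Z, W, Q, P) = (P - X\<^sup>2 * Y - Z\<^sup>2 * W - A 2 * Z) / T"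

definition H_eps :: "complex \<Rightarrow> (nat \<Rightarrow> complex) \<Rightarrow> hamiltonian" where
  "H_eps \<epsilon> A = (\<lambda>T s. H_lim A T s + \<epsilon> * H_correction A T s)"

lemma H_eps_eq_rescaled_H:
  assumes "\<epsilon> \<noteq> 0" "parameter_change \<epsilon> \<alpha> A"
  shows "H_eps \<epsilon> A = (\<lambda>T s. \<epsilon> * H \<alpha> (\<epsilon> * T) (rescale \<epsilon> s))"
proof (intro ext)
  fix T and s :: phase
  obtain X Y Z W Q P where s: "s = (X, Y, Z, W, Q, P)"
    by (metis prod.exhaust)
  have \<alpha>: "\<alpha> 0 = 1 / \<epsilon> + 2 * A 0" "\<alpha> 1 = - 1 / \<epsilon>" "\<alpha> (Suc 0) = - 1 / \<epsilon>" "\<alpha> 2 = A 1" "\<alpha> 3 = A 2"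
    "\<alpha> 5 = A 4" "\<alpha> 6 = A 5"
    using assms(2) by (auto simp: parameter_change_def)
  show "H_eps \<epsilon> A T s = \<epsilon> * H \<alpha> (\<epsilon> * T) (rescale \<epsilon> s)"
  proof (cases "T = 0")
    case True
    \<comment> \<open>Both sides vanish because division by zero gives zero.\<close>
    then show ?thesis by (simp add: s H_eps_def)
  next
    case False
    then show ?thesis
      using assms(1) by (simp add: s H_eps_def \<alpha> field_simps power2_eq_square)
  qed
qed

lemma separately_holomorphic_H: "separately_holomorphic (H \<alpha> t)"
  unfolding separately_holomorphic_def divide_inverse H.simps
  by (intro allI conjI) (auto intro!: derivative_intros)

lemma separately_holomorphic_H_lim: "separately_holomorphic (H_lim A T)"
  unfolding separately_holomorphic_def H_lim.simps
  by (cases "T = 0") (auto intro!: derivative_intros)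

lemma separately_holomorphic_H_correction: "separately_holomorphic (H_correction A T)"
  unfolding separately_holomorphic_def H_correction.simps divide_inverse
  by (intro allI conjI) (auto intro!: derivative_intros)

lemma separately_holomorphic_H_eps: "separately_holomorphic (H_eps \<epsilon> A T)"
  using separately_holomorphic_H_lim[of A T] separately_holomorphic_H_correction[of A T]
  unfolding separately_holomorphic_def H_eps_def
  by (auto intro!: derivative_intros simp del: H_lim.simps H_correction.simps)

lemma alpha_normalized_iff_A_normalized:
  assumes "parameter_change \<epsilon> \<alpha> A"
  shows "alpha_normalized \<alpha> \<longleftrightarrow> A_normalized A"
  using assms by (simp add: parameter_change_def alpha_normalized_def A_normalized_def)

lemma rewrites_as_H_eps:
  assumes "\<epsilon> \<noteq> 0" "parameter_change \<epsilon> \<alpha> A"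
  shows "rewrites_as_hamiltonian_system \<epsilon> \<alpha> (H_eps \<epsilon> A)"
  unfolding rewrites_as_hamiltonian_system_def
proof (intro conjI allI impI separately_holomorphic_H_eps)
  fix D x y z w q p X Y Z W Q P
  assume "open D \<and> 0 \<notin> D \<and> variable_change \<epsilon> D x y z w q p X Y Z W Q P"
  then show "solves_hamiltonian_system (H \<alpha>) ((\<lambda>T. \<epsilon> * T) ` D) x y z w q p \<longleftrightarrow>
      solves_hamiltonian_system (H_eps \<epsilon> A) D X Y Z W Q P"
    unfolding H_eps_eq_rescaled_H[OF assms]
    by (intro solves_hamiltonian_system_rescale assms(1) separately_holomorphic_H) auto
qed

theorem theorem3p7:
  "(\<forall>\<epsilon> \<alpha> A. \<epsilon> \<noteq> 0 \<and> parameter_change \<epsilon> \<alpha> A \<longrightarrow>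
      (alpha_normalized \<alpha> \<longleftrightarrow> A_normalized A)) \<and>
   (\<exists>K :: complex \<Rightarrow> (nat \<Rightarrow> complex) \<Rightarrow> hamiltonian.
      (\<forall>\<epsilon> \<alpha> A. \<epsilon> \<noteq> 0 \<and> alpha_normalized \<alpha> \<and> parameter_change \<epsilon> \<alpha> A \<longrightarrow>
         rewrites_as_hamiltonian_system \<epsilon> \<alpha> (K \<epsilon> A)) \<and>
      (\<forall>A T s. A_normalized A \<and> T \<noteq> 0 \<longrightarrow>
         ((\<lambda>\<epsilon>. hamiltonian_rhs (K \<epsilon> A) T s) \<longlongrightarrow> hamiltonian_rhs (H_lim A) T s) (at 0)))"
proof (intro conjI exI[of _ H_eps] allI impI)
  fix A T s
  show "((\<lambda>\<epsilon>. hamiltonian_rhs (H_eps \<epsilon> A) T s) \<longlongrightarrow> hamiltonian_rhs (H_lim A) T s) (at 0)"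
    unfolding H_eps_def
    by (rule tendsto_hamiltonian_rhs_affine
          [OF separately_holomorphic_H_lim separately_holomorphic_H_correction])
qed (use alpha_normalized_iff_A_normalized rewrites_as_H_eps in auto)

end
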